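(* Let $\alpha<\beta$ be real numbers. Let $u(t)$, $b(t)$, $k(t,s)$, $h(t,s,\sigma)$ be nonnegative continuous functions for $\alpha\le\sigma\le s\le t\le\beta$ and suppose that $$u(t)\le a+\int_\alpha^t b(s)u^p(s)\,ds+\int_\alpha^t\int_\alpha^s k(s,\tau)u^p(\tau)\,d\tau\,ds+\int_\alpha^t\int_\alpha^s\int_\alpha^\tau h(s,\tau,\sigma)u^p(\sigma)\,d\sigma\,d\tau\,ds$$ for any $t\in[\alpha,\beta]$, where $a>0$ and $p\ge 0$ ($p\ne 1$) are constants. Then $$u(t)\le\left[a^q+q\int_\alpha^t\left(b(s)+\int_\alpha^s k(s,\tau)\,d\tau+\int_\alpha^s\int_\alpha^\tau h(s,\tau,\sigma)\,d\sigma\,d\tau\right)ds\right]^{1/q}$$ for any $t\in[\alpha,\beta_1)$, where $q=1-p$ and $\beta_1\in(\alpha,\beta]$ is chosen so that the expression between $[\cdots]$ is positive in the subinterval $[\alpha,\beta_1)$.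
   Context: All functions are real-valued. The functions $u,b$ are defined on $[\alpha,\beta]$, $k$ on $\{(t,s):\alpha\le s\le t\le\beta\}$, and $h$ on $\{(t,s,\sigma):\alpha\le\sigma\le s\le t\le\beta\}$. The notation $u^p(s)$ means $(u(s))^p$. *)

theory Defs
  imports "HOL-Analysis.Analysis"
begin

text \<open>
  Real power \<open>x\<^sup>p\<close> of a base \<open>x \<ge> 0\<close> with exponent \<open>p \<ge> 0\<close>, with the usual
  convention \<open>0\<^sup>0 = 1\<close>. It differs from \<open>powr\<close> on such arguments only at
  \<open>x = 0\<close>, \<open>p = 0\<close>, where \<open>0 powr 0 = 0\<close>.
\<close>

definition rpow :: "real \<Rightarrow> real \<Rightarrow> real"
  where "rpow x p = (if p = 0 then 1 else x powr p)"

definition bihari_bracket ::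
  "real \<Rightarrow> real \<Rightarrow> real \<Rightarrow> (real \<Rightarrow> real) \<Rightarrow> (real \<Rightarrow> real \<Rightarrow> real) \<Rightarrow>
   (real \<Rightarrow> real \<Rightarrow> real \<Rightarrow> real) \<Rightarrow> real \<Rightarrow> real"
  where "bihari_bracket \<alpha> a q b k h t =
    a powr q + q * integral {\<alpha>..t} (\<lambda>s. b s + integral {\<alpha>..s} (\<lambda>\<tau>. k s \<tau>)
      + integral {\<alpha>..s} (\<lambda>\<tau>. integral {\<alpha>..\<tau>} (\<lambda>\<sigma>. h s \<tau> \<sigma>)))"

end

theory Submission
  imports Defs
begin

text \<open>
  Let \<open>z t\<close> be the right-hand side of the hypothesis. It has the form
  \<open>a + integral {\<alpha>..t} g\<close>, where \<open>g s\<close> collects the three kernels at time \<open>s\<close>, all applied to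
  \<open>u\<^sup>p\<close> on \<open>[\<alpha>, s]\<close>. So \<open>z\<close> is nondecreasing, \<open>z \<ge> a > 0\<close> and \<open>u \<le> z\<close>. Since \<open>p \<ge> 0\<close>, on all of
  \<open>[\<alpha>, s]\<close> the history \<open>u\<^sup>p\<close> is at most \<open>(z s)\<^sup>p\<close>, a constant that can be pulled out of the
  integrals. This eliminates the memory and leaves the ordinary differential inequality
  \<open>z' \<le> G z\<^sup>p\<close>, where \<open>G s\<close> is the total mass of the kernels at time \<open>s\<close>
  (\<open>memory_rate_le\<close>). Separating variables, \<open>(z\<^sup>q / q)' = z' z\<^sup>-\<^sup>p \<le> G\<close>, hence
  \<open>z\<^sup>q / q \<le> a\<^sup>q / q + \<integral> G\<close> (\<open>bernoulli_differential_inequality\<close>).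

  Multiplying by \<open>q\<close> bounds \<open>z\<^sup>q\<close> by the bracket from above if \<open>q > 0\<close> and from below if
  \<open>q < 0\<close>; the root \<open>1 / q\<close> is increasing or decreasing accordingly, so both cases give the same
  upper bound for \<open>z\<close>. For \<open>q < 0\<close> this needs the bracket to be positive.

  The analytic input is that the iterated integrals depend continuously on their upper limits,
  which makes \<open>z\<close> differentiable (\<open>continuous_on_integral_variable_limit\<close>).
\<close>

section \<open>Integrals with a variable upper limit\<close>

text \<open>
  Rescaling \<open>[l, c x]\<close> to \<open>[0, 1]\<close> moves the variable limit into the integrand, where the
  continuity of integrals over a fixed interval in a parameter applies.
\<close>

lemma continuous_on_integral_variable_limit:
  fixes f :: "'a::topological_space \<Rightarrow> real \<Rightarrow> real" and c :: "'a \<Rightarrow> real"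
  assumes c: "continuous_on S c" and lc: "\<And>x. x \<in> S \<Longrightarrow> l \<le> c x"
    and f: "continuous_on {(x, r). x \<in> S \<and> l \<le> r \<and> r \<le> c x} (\<lambda>(x, r). f x r)"
  shows "continuous_on S (\<lambda>x. integral {l..c x} (f x))"
proof -
  have rescale: "integral {l..c x} (f x) = (c x - l) * integral (cbox 0 1) (\<lambda>r. f x ((c x - l) * r + l))"
    if x: "x \<in> S" for x
  proof (cases "c x = l")
    case True
    then show ?thesis by simp
  next
    case False
    with lc[OF x] have pos: "0 < c x - l" by simp
    have "continuous_on {l..c x} (\<lambda>r. (case (x, r) of (x, r) \<Rightarrow> f x r))"
      by (rule continuous_on_compose2[OF f]) (auto intro!: continuous_intros simp: x)
    then have "(f x has_integral integral {l..c x} (f x)) (cbox l (c x))"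
      by (simp add: integrable_continuous_real integrable_integral)
    from has_integral_affinity'[OF this pos, of l] pos
    have "((\<lambda>r. f x ((c x - l) * r + l)) has_integral integral {l..c x} (f x) / (c x - l)) (cbox 0 1)"
      by (simp add: field_simps)
    then show ?thesis
      using pos by (simp add: integral_unique)
  qed
  have "continuous_on (S \<times> cbox 0 1) (\<lambda>y. (case (fst y, (c (fst y) - l) * snd y + l) of (x, r) \<Rightarrow> f x r))"
  proof (rule continuous_on_compose2[OF f])
    show "continuous_on (S \<times> cbox 0 1) (\<lambda>y. (fst y, (c (fst y) - l) * snd y + l))"
      by (intro continuous_intros continuous_on_compose2[OF c]) auto
    have "(c x - l) * r + l \<le> c x" if "x \<in> S" "0 \<le> r" "r \<le> 1" for x r
      using mult_left_mono[OF \<open>r \<le> 1\<close>, of "c x - l"] lc[OF \<open>x \<in> S\<close>] by simp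
    then show "(\<lambda>y. (fst y, (c (fst y) - l) * snd y + l)) ` (S \<times> cbox 0 1)
        \<subseteq> {(x, r). x \<in> S \<and> l \<le> r \<and> r \<le> c x}"
      using lc by auto
  qed
  then have "continuous_on (S \<times> cbox 0 1) (\<lambda>(x, r). f x ((c x - l) * r + l))"
    by (simp add: case_prod_unfold)
  then have "continuous_on S (\<lambda>x. (c x - l) * integral (cbox 0 1) (\<lambda>r. f x ((c x - l) * r + l)))"
    by (intro continuous_intros c integral_continuous_on_param)
  then show ?thesis
    by (rule continuous_on_eq) (simp add: rescale)
qed

section \<open>The memory operator\<close>

definition memory_rate ::
  "real \<Rightarrow> (real \<Rightarrow> real) \<Rightarrow> (real \<Rightarrow> real \<Rightarrow> real) \<Rightarrow> (real \<Rightarrow> real \<Rightarrow> real \<Rightarrow> real) \<Rightarrow>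
   (real \<Rightarrow> real) \<Rightarrow> real \<Rightarrow> real"
  where "memory_rate \<alpha> b k h w s =
    b s * w s + integral {\<alpha>..s} (\<lambda>\<tau>. k s \<tau> * w \<tau>)
      + integral {\<alpha>..s} (\<lambda>\<tau>. integral {\<alpha>..\<tau>} (\<lambda>\<sigma>. h s \<tau> \<sigma> * w \<sigma>))"

text \<open>
  The assumptions on the three kernels are shared by all facts about the operator; the input
  \<open>w\<close> stays arbitrary, because the proof applies the operator both to \<open>u\<^sup>p\<close> and to the
  constant function \<open>1\<close>.
\<close>

locale memory_kernels =
  fixes \<alpha> \<beta> :: real and b :: "real \<Rightarrow> real"
    and k :: "real \<Rightarrow> real \<Rightarrow> real" and h :: "real \<Rightarrow> real \<Rightarrow> real \<Rightarrow> real"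
  assumes b_cont: "continuous_on {\<alpha>..\<beta>} b"
    and b_nonneg: "\<And>t. t \<in> {\<alpha>..\<beta>} \<Longrightarrow> 0 \<le> b t"
    and k_cont: "continuous_on {(t, s). \<alpha> \<le> s \<and> s \<le> t \<and> t \<le> \<beta>} (\<lambda>(t, s). k t s)"
    and k_nonneg: "\<And>t s. \<alpha> \<le> s \<Longrightarrow> s \<le> t \<Longrightarrow> t \<le> \<beta> \<Longrightarrow> 0 \<le> k t s"
    and h_cont: "continuous_on {(t, s, \<sigma>). \<alpha> \<le> \<sigma> \<and> \<sigma> \<le> s \<and> s \<le> t \<and> t \<le> \<beta>}
      (\<lambda>(t, s, \<sigma>). h t s \<sigma>)"
    and h_nonneg: "\<And>t s \<sigma>. \<alpha> \<le> \<sigma> \<Longrightarrow> \<sigma> \<le> s \<Longrightarrow> s \<le> t \<Longrightarrow> t \<le> \<beta> \<Longrightarrow> 0 \<le> h t s \<sigma>"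
begin

lemma k_weighted_cont:
  assumes w: "continuous_on {\<alpha>..\<beta>} w"
  shows "continuous_on {(t, s). t \<in> {\<alpha>..\<beta>} \<and> \<alpha> \<le> s \<and> s \<le> t} (\<lambda>(t, s). k t s * w s)"
proof -
  have "{(t, s). t \<in> {\<alpha>..\<beta>} \<and> \<alpha> \<le> s \<and> s \<le> t} = {(t, s). \<alpha> \<le> s \<and> s \<le> t \<and> t \<le> \<beta>}"
    by auto
  moreover have "continuous_on {(t, s). \<alpha> \<le> s \<and> s \<le> t \<and> t \<le> \<beta>} (\<lambda>y. (case y of (t, s) \<Rightarrow> k t s) * w (snd y))"
    by (intro continuous_intros k_cont continuous_on_compose2[OF w]) auto
  ultimately show ?thesis by (simp add: case_prod_unfold)
qed

lemma h_weighted_cont: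
  assumes w: "continuous_on {\<alpha>..\<beta>} w"
  shows "continuous_on {(y, \<sigma>). y \<in> {(t, s). t \<in> {\<alpha>..\<beta>} \<and> \<alpha> \<le> s \<and> s \<le> t} \<and> \<alpha> \<le> \<sigma> \<and> \<sigma> \<le> snd y}
    (\<lambda>(y, \<sigma>). h (fst y) (snd y) \<sigma> * w \<sigma>)" (is "continuous_on ?D _")
proof -
  have "continuous_on ?D (\<lambda>y. (case (fst (fst y), snd (fst y), snd y) of (t, s, \<sigma>) \<Rightarrow> h t s \<sigma>) * w (snd y))"
    by (rule continuous_on_mult[OF continuous_on_compose2[OF h_cont] continuous_on_compose2[OF w]])
      (auto intro!: continuous_intros)
  then show ?thesis by (simp add: case_prod_unfold)
qed

lemma h_inner_integral_cont:
  assumes w: "continuous_on {\<alpha>..\<beta>} w"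
  shows "continuous_on {(t, s). t \<in> {\<alpha>..\<beta>} \<and> \<alpha> \<le> s \<and> s \<le> t}
    (\<lambda>(t, s). integral {\<alpha>..s} (\<lambda>\<sigma>. h t s \<sigma> * w \<sigma>))"
proof -
  have "continuous_on {(t, s). t \<in> {\<alpha>..\<beta>} \<and> \<alpha> \<le> s \<and> s \<le> t}
    (\<lambda>y. integral {\<alpha>..snd y} (\<lambda>\<sigma>. h (fst y) (snd y) \<sigma> * w \<sigma>))"
    by (rule continuous_on_integral_variable_limit[OF _ _ h_weighted_cont[OF w]])
      (auto intro!: continuous_intros)
  then show ?thesis by (simp add: case_prod_unfold)
qed

lemma k_integral_cont:
  assumes w: "continuous_on {\<alpha>..\<beta>} w"
  shows "continuous_on {\<alpha>..\<beta>} (\<lambda>s. integral {\<alpha>..s} (\<lambda>\<tau>. k s \<tau> * w \<tau>))"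
  by (rule continuous_on_integral_variable_limit[OF _ _ k_weighted_cont[OF w]])
    (auto intro!: continuous_intros)

lemma h_iterated_integral_cont:
  assumes w: "continuous_on {\<alpha>..\<beta>} w"
  shows "continuous_on {\<alpha>..\<beta>}
    (\<lambda>s. integral {\<alpha>..s} (\<lambda>\<tau>. integral {\<alpha>..\<tau>} (\<lambda>\<sigma>. h s \<tau> \<sigma> * w \<sigma>)))"
  by (rule continuous_on_integral_variable_limit[OF _ _ h_inner_integral_cont[OF w]])
    (auto intro!: continuous_intros)

lemma continuous_on_memory_rate:
  assumes "continuous_on {\<alpha>..\<beta>} w"
  shows "continuous_on {\<alpha>..\<beta>} (memory_rate \<alpha> b k h w)"
  unfolding memory_rate_def
  by (intro continuous_intros assms b_cont k_integral_cont h_iterated_integral_cont)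

lemma integral_memory_rate:
  assumes w: "continuous_on {\<alpha>..\<beta>} w" and t: "t \<in> {\<alpha>..\<beta>}"
  shows "integral {\<alpha>..t} (memory_rate \<alpha> b k h w) =
    integral {\<alpha>..t} (\<lambda>s. b s * w s)
      + integral {\<alpha>..t} (\<lambda>s. integral {\<alpha>..s} (\<lambda>\<tau>. k s \<tau> * w \<tau>))
      + integral {\<alpha>..t} (\<lambda>s. integral {\<alpha>..s} (\<lambda>\<tau>. integral {\<alpha>..\<tau>} (\<lambda>\<sigma>. h s \<tau> \<sigma> * w \<sigma>)))"
proof -
  have integrable: "f integrable_on {\<alpha>..t}" if "continuous_on {\<alpha>..\<beta>} f" for f :: "real \<Rightarrow> real"
    using t by (intro integrable_continuous_real continuous_on_subset[OF that]) auto
  note int = integrable[OF continuous_on_mult[OF b_cont w]]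
    integrable[OF k_integral_cont[OF w]] integrable[OF h_iterated_integral_cont[OF w]]
  show ?thesis
    unfolding memory_rate_def
    by (simp add: integral_add int integrable_add)
qed

lemma kernel_slices_integrable:
  assumes w: "continuous_on {\<alpha>..\<beta>} w" and s: "s \<in> {\<alpha>..\<beta>}"
  shows "(\<lambda>\<tau>. k s \<tau> * w \<tau>) integrable_on {\<alpha>..s}"
    and "(\<lambda>\<tau>. integral {\<alpha>..\<tau>} (\<lambda>\<sigma>. h s \<tau> \<sigma> * w \<sigma>)) integrable_on {\<alpha>..s}"
    and "\<And>\<tau>. \<tau> \<in> {\<alpha>..s} \<Longrightarrow> (\<lambda>\<sigma>. h s \<tau> \<sigma> * w \<sigma>) integrable_on {\<alpha>..\<tau>}"
proof -
  have "continuous_on {\<alpha>..s} (\<lambda>\<tau>. (case (s, \<tau>) of (t, \<tau>) \<Rightarrow> k t \<tau> * w \<tau>))"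
    by (rule continuous_on_compose2[OF k_weighted_cont[OF w]]) (use s in \<open>auto intro!: continuous_intros\<close>)
  then show "(\<lambda>\<tau>. k s \<tau> * w \<tau>) integrable_on {\<alpha>..s}"
    by (simp add: integrable_continuous_real)
  have "continuous_on {\<alpha>..s} (\<lambda>\<tau>. (case (s, \<tau>) of (t, \<tau>) \<Rightarrow> integral {\<alpha>..\<tau>} (\<lambda>\<sigma>. h t \<tau> \<sigma> * w \<sigma>)))"
    by (rule continuous_on_compose2[OF h_inner_integral_cont[OF w]]) (use s in \<open>auto intro!: continuous_intros\<close>)
  then show "(\<lambda>\<tau>. integral {\<alpha>..\<tau>} (\<lambda>\<sigma>. h s \<tau> \<sigma> * w \<sigma>)) integrable_on {\<alpha>..s}"
    by (simp add: integrable_continuous_real)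
  fix \<tau> assume \<tau>: "\<tau> \<in> {\<alpha>..s}"
  have "continuous_on {\<alpha>..\<tau>} (\<lambda>\<sigma>. (case ((s, \<tau>), \<sigma>) of (y, \<sigma>) \<Rightarrow> h (fst y) (snd y) \<sigma> * w \<sigma>))"
    by (rule continuous_on_compose2[OF h_weighted_cont[OF w]]) (use s \<tau> in \<open>auto intro!: continuous_intros\<close>)
  then show "(\<lambda>\<sigma>. h s \<tau> \<sigma> * w \<sigma>) integrable_on {\<alpha>..\<tau>}"
    by (simp add: integrable_continuous_real)
qed

lemma memory_rate_mono:
  assumes v: "continuous_on {\<alpha>..\<beta>} v" and w: "continuous_on {\<alpha>..\<beta>} w" and s: "s \<in> {\<alpha>..\<beta>}"
    and le: "\<And>r. r \<in> {\<alpha>..s} \<Longrightarrow> v r \<le> w r"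
  shows "memory_rate \<alpha> b k h v s \<le> memory_rate \<alpha> b k h w s"
  unfolding memory_rate_def
proof (intro add_mono)
  show "b s * v s \<le> b s * w s"
    using s by (intro mult_left_mono le b_nonneg) auto
  show "integral {\<alpha>..s} (\<lambda>\<tau>. k s \<tau> * v \<tau>) \<le> integral {\<alpha>..s} (\<lambda>\<tau>. k s \<tau> * w \<tau>)"
    using s by (intro integral_le kernel_slices_integrable v w mult_left_mono le k_nonneg) auto
  show "integral {\<alpha>..s} (\<lambda>\<tau>. integral {\<alpha>..\<tau>} (\<lambda>\<sigma>. h s \<tau> \<sigma> * v \<sigma>))
      \<le> integral {\<alpha>..s} (\<lambda>\<tau>. integral {\<alpha>..\<tau>} (\<lambda>\<sigma>. h s \<tau> \<sigma> * w \<sigma>))"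
    using s by (intro integral_le kernel_slices_integrable v w mult_left_mono le h_nonneg) auto
qed

lemma memory_rate_const:
  "memory_rate \<alpha> b k h (\<lambda>_. C) s = memory_rate \<alpha> b k h (\<lambda>_. 1) s * C"
  by (simp add: memory_rate_def algebra_simps)

text \<open>
  A bound for the input over the whole past factors out of the operator. This is what turns the
  integral inequality into a differential inequality without memory.
\<close>

lemma memory_rate_le:
  assumes "continuous_on {\<alpha>..\<beta>} w" and "s \<in> {\<alpha>..\<beta>}" and "\<And>r. r \<in> {\<alpha>..s} \<Longrightarrow> w r \<le> C"
  shows "memory_rate \<alpha> b k h w s \<le> memory_rate \<alpha> b k h (\<lambda>_. 1) s * C"
  using memory_rate_mono[of w "\<lambda>_. C" s] assms by (simp add: memory_rate_const[of C])

lemma memory_rate_nonneg: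
  assumes "continuous_on {\<alpha>..\<beta>} w" and "s \<in> {\<alpha>..\<beta>}" and "\<And>r. r \<in> {\<alpha>..s} \<Longrightarrow> 0 \<le> w r"
  shows "0 \<le> memory_rate \<alpha> b k h w s"
  using memory_rate_mono[of "\<lambda>_. 0" w s] assms by (simp add: memory_rate_const[of 0])

end

section \<open>The Bernoulli differential inequality\<close>

text \<open>
  Separation of variables: \<open>z powr q / q\<close> has derivative \<open>z' * z powr (q - 1)\<close>, in
  which the new factor cancels the one in the bound for \<open>z'\<close>.
\<close>

lemma bernoulli_differential_inequality:
  fixes z z' G :: "real \<Rightarrow> real"
  assumes "l \<le> t" and q: "q \<noteq> 0" and G: "continuous_on {l..t} G"
    and z_pos: "\<And>s. s \<in> {l..t} \<Longrightarrow> 0 < z s"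
    and z': "\<And>s. s \<in> {l..t} \<Longrightarrow> (z has_real_derivative z' s) (at s within {l..t})"
    and le: "\<And>s. s \<in> {l..t} \<Longrightarrow> z' s \<le> G s * z s powr (1 - q)"
  shows "z t powr q / q \<le> z l powr q / q + integral {l..t} G"
proof -
  define \<Phi> where "\<Phi> s = z s powr q / q - integral {l..s} G" for s
  have \<Phi>: "(\<Phi> has_real_derivative z' s * z s powr (q - 1) - G s) (at s within {l..t})"
    if s: "s \<in> {l..t}" for s
  proof -
    have "((\<lambda>s. z s powr q) has_real_derivative (q * z s powr (q - 1)) * z' s) (at s within {l..t})"
      by (rule DERIV_chain2[OF has_real_derivative_powr[OF z_pos[OF s]] z'[OF s]])
    from DERIV_diff[OF DERIV_cdivide[OF this, of q] integral_has_real_derivative[OF G s]] q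
    show ?thesis
      unfolding \<Phi>_def by (simp add: mult.commute)
  qed
  have "\<Phi> t \<le> \<Phi> l"
  proof (rule DERIV_nonpos_imp_decreasing_open[OF \<open>l \<le> t\<close>])
    show "continuous_on {l..t} \<Phi>"
      using \<Phi> by (meson DERIV_continuous continuous_on_eq_continuous_within)
    fix s assume "l < s" "s < t"
    then have s: "s \<in> {l..t}" and "at s within {l..t} = at s"
      by (auto simp: at_within_Icc_at)
    with \<Phi>[OF s] have "(\<Phi> has_real_derivative z' s * z s powr (q - 1) - G s) (at s)"
      by simp
    moreover have "z' s * z s powr (q - 1) \<le> G s * z s powr (1 - q) * z s powr (q - 1)"
      by (intro mult_right_mono le s) simp
    then have "z' s * z s powr (q - 1) - G s \<le> 0"
      using z_pos[OF s] by (simp add: mult.assoc flip: powr_add)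
    ultimately show "\<exists>y. (\<Phi> has_real_derivative y) (at s) \<and> y \<le> 0"
      by blast
  qed
  then show ?thesis by (simp add: \<Phi>_def)
qed

text \<open>
  For negative \<open>q\<close> both the multiplication by \<open>q\<close> and the root \<open>1 / q\<close> reverse the
  order, and the two reversals cancel.
\<close>

lemma le_powr_inverse_if_powr_div_le:
  fixes x y q :: real
  assumes "0 < x" "0 < y" "q \<noteq> 0" and le: "x powr q / q \<le> y / q"
  shows "x \<le> y powr (1 / q)"
proof -
  have root: "(x powr q) powr (1 / q) = x"
    using assms by (simp add: powr_powr)
  show ?thesis
  proof (cases "0 < q")
    case True
    with le have "x powr q \<le> y" by (simp add: divide_le_cancel)
    with True have "(x powr q) powr (1 / q) \<le> y powr (1 / q)"
      by (intro powr_mono2) auto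
    with root show ?thesis by simp
  next
    case False
    with \<open>q \<noteq> 0\<close> have "q < 0" by simp
    with le have "y \<le> x powr q" by (simp add: divide_le_cancel)
    with \<open>q < 0\<close> \<open>0 < y\<close> have "(x powr q) powr (1 / q) \<le> y powr (1 / q)"
      by (intro powr_mono2') auto
    with root show ?thesis by simp
  qed
qed

section \<open>The nonlinear integral inequality\<close>

lemma rpow_nonneg: "0 \<le> rpow x p"
  by (simp add: rpow_def)

lemma rpow_mono: "0 \<le> p \<Longrightarrow> 0 \<le> x \<Longrightarrow> x \<le> y \<Longrightarrow> rpow x p \<le> rpow y p"
  by (simp add: rpow_def powr_mono2)

lemma rpow_eq_powr: "0 < x \<Longrightarrow> rpow x p = x powr p"
  by (simp add: rpow_def)

lemma continuous_on_rpow: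
  assumes "continuous_on S f" and "0 \<le> p" and "\<And>x. x \<in> S \<Longrightarrow> 0 \<le> f x"
  shows "continuous_on S (\<lambda>x. rpow (f x) p)"
proof (cases "p = 0")
  case True
  then show ?thesis by (simp add: rpow_def)
next
  case False
  with assms have "continuous_on S (\<lambda>x. f x powr p)"
    by (intro continuous_on_powr') auto
  with False show ?thesis by (simp add: rpow_def)
qed

lemma bihari_bracket_eq:
  "bihari_bracket \<alpha> a q b k h t =
    a powr q + q * integral {\<alpha>..t} (memory_rate \<alpha> b k h (\<lambda>_. 1))"
  by (simp add: bihari_bracket_def memory_rate_def[abs_def])

theorem theorem3p2:
  fixes \<alpha> \<beta> \<beta>1 a p q :: real
    and u b :: "real \<Rightarrow> real"
    and k :: "real \<Rightarrow> real \<Rightarrow> real"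
    and h :: "real \<Rightarrow> real \<Rightarrow> real \<Rightarrow> real"
  assumes "\<alpha> < \<beta>"
    and "continuous_on {\<alpha>..\<beta>} u" and "\<And>t. t \<in> {\<alpha>..\<beta>} \<Longrightarrow> 0 \<le> u t"
    and "continuous_on {\<alpha>..\<beta>} b" and "\<And>t. t \<in> {\<alpha>..\<beta>} \<Longrightarrow> 0 \<le> b t"
    and "continuous_on {(t, s). \<alpha> \<le> s \<and> s \<le> t \<and> t \<le> \<beta>} (\<lambda>(t, s). k t s)"
    and "\<And>t s. \<alpha> \<le> s \<Longrightarrow> s \<le> t \<Longrightarrow> t \<le> \<beta> \<Longrightarrow> 0 \<le> k t s"
    and "continuous_on {(t, s, \<sigma>). \<alpha> \<le> \<sigma> \<and> \<sigma> \<le> s \<and> s \<le> t \<and> t \<le> \<beta>} (\<lambda>(t, s, \<sigma>). h t s \<sigma>)"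
    and "\<And>t s \<sigma>. \<alpha> \<le> \<sigma> \<Longrightarrow> \<sigma> \<le> s \<Longrightarrow> s \<le> t \<Longrightarrow> t \<le> \<beta> \<Longrightarrow> 0 \<le> h t s \<sigma>"
    and "a > 0" and "p \<ge> 0" and "p \<noteq> 1"
    and "\<And>t. t \<in> {\<alpha>..\<beta>} \<Longrightarrow>
      u t \<le> a + integral {\<alpha>..t} (\<lambda>s. b s * rpow (u s) p)
        + integral {\<alpha>..t} (\<lambda>s. integral {\<alpha>..s} (\<lambda>\<tau>. k s \<tau> * rpow (u \<tau>) p))
        + integral {\<alpha>..t} (\<lambda>s. integral {\<alpha>..s} (\<lambda>\<tau>. integral {\<alpha>..\<tau>}
            (\<lambda>\<sigma>. h s \<tau> \<sigma> * rpow (u \<sigma>) p)))"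
    and "q = 1 - p"
    and "\<beta>1 \<in> {\<alpha><..\<beta>}"
    and "\<And>t. t \<in> {\<alpha>..<\<beta>1} \<Longrightarrow> bihari_bracket \<alpha> a q b k h t > 0"
  shows "\<forall>t\<in>{\<alpha>..<\<beta>1}. u t \<le> bihari_bracket \<alpha> a q b k h t powr (1 / q)"
proof
  interpret memory_kernels \<alpha> \<beta> b k h
    by unfold_locales (fact assms)+
  define w where "w s = rpow (u s) p" for s
  define g where "g = memory_rate \<alpha> b k h w"
  define G where "G = memory_rate \<alpha> b k h (\<lambda>_. 1)"
  define z where "z t = a + integral {\<alpha>..t} g" for t
  have w_cont: "continuous_on {\<alpha>..\<beta>} w"
    unfolding w_def using assms(2,3) \<open>p \<ge> 0\<close> by (intro continuous_on_rpow) auto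
  have g_cont: "continuous_on {\<alpha>..\<beta>} g"
    unfolding g_def by (rule continuous_on_memory_rate[OF w_cont])
  have G_cont: "continuous_on {\<alpha>..\<beta>} G"
    unfolding G_def by (intro continuous_on_memory_rate continuous_intros)
  have g_nonneg: "0 \<le> g s" if "s \<in> {\<alpha>..\<beta>}" for s
    unfolding g_def by (rule memory_rate_nonneg[OF w_cont that]) (simp add: w_def rpow_nonneg)
  have u_le_z: "u t \<le> z t" if "t \<in> {\<alpha>..\<beta>}" for t
    using assms(13)[OF that] integral_memory_rate[OF w_cont that]
    by (simp add: z_def g_def w_def)
  have z_mono: "z r \<le> z s" if "\<alpha> \<le> r" "r \<le> s" "s \<le> \<beta>" for r s
    unfolding z_def using that g_nonneg
    by (intro add_left_mono integral_subset_le integrable_continuous_real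
        continuous_on_subset[OF g_cont]) auto
  have z_pos: "0 < z s" if "s \<in> {\<alpha>..\<beta>}" for s
    using z_mono[of \<alpha> s] that \<open>a > 0\<close> by (auto simp: z_def)
  have z_deriv: "(z has_real_derivative g s) (at s within {\<alpha>..\<beta>})" if "s \<in> {\<alpha>..\<beta>}" for s
    unfolding z_def
    using DERIV_add[OF DERIV_const integral_has_real_derivative[OF g_cont that]] by simp
  have g_le: "g s \<le> G s * z s powr p" if s: "s \<in> {\<alpha>..\<beta>}" for s
    unfolding g_def G_def
  proof (rule memory_rate_le[OF w_cont s])
    fix r assume r: "r \<in> {\<alpha>..s}"
    with s have "u r \<le> z s"
      using u_le_z[of r] z_mono[of r s] by auto
    then show "w r \<le> z s powr p"
      using rpow_mono[of p "u r" "z s"] rpow_eq_powr[OF z_pos[OF s]] assms(3)[of r] r s \<open>p \<ge> 0\<close>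
      by (simp add: w_def)
  qed
  fix t assume t: "t \<in> {\<alpha>..<\<beta>1}"
  with \<open>\<beta>1 \<in> {\<alpha><..\<beta>}\<close> have t\<beta>: "t \<in> {\<alpha>..\<beta>}" and sub: "{\<alpha>..t} \<subseteq> {\<alpha>..\<beta>}"
    by auto
  have q: "q \<noteq> 0" "p = 1 - q"
    using \<open>q = 1 - p\<close> \<open>p \<noteq> 1\<close> by auto
  have "z t powr q / q \<le> z \<alpha> powr q / q + integral {\<alpha>..t} G"
  proof (rule bernoulli_differential_inequality)
    fix s assume "s \<in> {\<alpha>..t}"
    with sub have s: "s \<in> {\<alpha>..\<beta>}" by auto
    show "0 < z s" by (rule z_pos[OF s])
    show "(z has_real_derivative g s) (at s within {\<alpha>..t})"
      by (rule has_field_derivative_subset[OF z_deriv[OF s] sub])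
    show "g s \<le> G s * z s powr (1 - q)"
      using g_le[OF s] q by simp
  qed (use t q continuous_on_subset[OF G_cont sub] in auto)
  also have "\<dots> = bihari_bracket \<alpha> a q b k h t / q"
    using q by (simp add: bihari_bracket_eq z_def G_def field_simps)
  finally have "z t \<le> bihari_bracket \<alpha> a q b k h t powr (1 / q)"
    using z_pos[OF t\<beta>] assms(16)[OF t] q by (intro le_powr_inverse_if_powr_div_le)
  with u_le_z[OF t\<beta>] show "u t \<le> bihari_bracket \<alpha> a q b k h t powr (1 / q)"
    by simp
qed

end
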